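(* Let $S(t)$ be an asymptotically compact semiflow on a complete metric space $X$, let $\mathscr{A}$ be an attractor of $S(t)$ with attraction basin $\Omega=\Omega(\mathscr{A})$ and Morse decomposition $\mathcal{M}=\{M_1,\dots,M_l\}$, and let $V$ be a strict Morse-Lyapunov function of $\mathcal{M}$ on $\Omega$. Assume that for some $1\le k_0\le l$ the Morse set $M_{k_0}$ consists of exactly one equilibrium $E$ of the semiflow. Let $c=V(E)$, and let $b>c$ be a number such that $V$ has no generalized critical values in $(c,b]$. Then $V_c$ is a strong deformation retract of $V_b$.
   Context: $(X,d)$ is a complete metric space. $C(U)$ denotes the continuous real-valued functions on $U$. A semiflow on $X$ is a continuous map $S:[0,\infty)\times X\to X$, written $S(t)x=S(t,x)$, with $S(0)x=x$ and $S(t+s)x=S(t)S(s)x$ for all $t,s\ge 0$, $x\in X$. It is asymptotically compact if, whenever $(x_n)$ is a bounded sequence in $X$, $t_n\to+\infty$ and $(S(t_n)x_n)$ is bounded, the sequence $(S(t_n)x_n)$ has a convergent subsequence. An equilibrium is a point $E$ with $S(t)E=E$ for all $t\ge0$. For $A\subset X$ and $\varepsilon>0$, $B(A,\varepsilon)=\{y\in X: d(y,A)<\varepsilon\}$. A set $U$ is a neighborhood of $A$ if $\overline{A}\subset\operatorname{int}U$. $A$ attracts $B\subset X$ if for every $\varepsilon>0$ there is $T>0$ with $S(t)B\subset B(A,\varepsilon)$ for all $t>T$. $A$ is invariant if $S(t)A=A$ for all $t\ge0$. An attractor is a compact invariant set that attracts some neighborhood of itself. The attraction basin of $A$ is $\Omega(A)=\{x: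 \lim_{t\to\infty}d(S(t)x,A)=0\}$ (an open set when $A$ is an attractor). Morse decompositions: let $\mathscr{A}$ be an attractor. A compact set $A\subset\mathscr{A}$ is an attractor of $S(t)$ in $\mathscr{A}$ if it is an attractor of the restriction of $S(t)$ to $\mathscr{A}$ (the empty set is allowed). Its dual repeller is $A^*=\{x\in\mathscr{A}:\omega(x)\cap A=\emptyset\}$, where $\omega(x)=\{y:\exists\,t_n\to+\infty,\ S(t_n)x\to y\}$. An ordered collection $\mathcal{M}=\{M_1,\dots,M_l\}$ of subsets of $\mathscr{A}$ is a Morse decomposition of $\mathscr{A}$, with Morse sets $M_k$, if there is a strictly increasing sequence $\emptyset=A_0\subsetneq A_1\subsetneq\cdots\subsetneq A_l=\mathscr{A}$ of attractors of $S(t)$ in $\mathscr{A}$ such that $M_k=A_k\cap A_{k-1}^*$ for $1\le k\le l$. Put $\mathcal{R}=\bigcup_{1\le k\le l}M_k$. A function $V\in C(\Omega)$ is a Morse-Lyapunov function of $\mathcal{M}$ on $\Omega$ if (1) $V$ is constant on each $M_k$ and (2) $t\mapsto V(S(t)x)$ is strictly decreasing in $t$ for each $x\in\Omega\setminus\mathcal{R}$. It is strict if in addition $V(M_1)<V(M_2)<\cdots<V(M_l)$, where $V(M_k)$ is the constant value of $V$ on $M_k$. The numbers $c_k=V(M_k)$, $1\le k\le l$, are the generalized critical values of $V$. For $a\in\mathbb{R}$, $V_a=\{x\in\Omega: V(x)\le a\}$. A subset $F$ of a topological space $E'$ is a strong deformation retract of $E'$ if there is a continuous map $H:[0,1]\times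 E'\to E'$ with $H(0,\cdot)=\mathrm{id}_{E'}$, $H(1,E')\subset F$, and $H(\sigma,\cdot)|_F=\mathrm{id}_F$ for all $\sigma\in[0,1]$. *)

theory Defs
  imports "HOL-Analysis.Analysis"
begin

section \<open>Semiflows\<close>

text \<open>The time axis is all of \<^typ>\<open>real\<close>, but only the values \<^term>\<open>S t\<close> with \<^term>\<open>0 \<le> t\<close> are
  ever constrained or used.\<close>

definition semiflow :: "(real \<Rightarrow> 'a::metric_space \<Rightarrow> 'a) \<Rightarrow> bool" where
  "semiflow S \<longleftrightarrow>
     continuous_on ({0..} \<times> UNIV) (\<lambda>(t, x). S t x) \<and>
     (\<forall>x. S 0 x = x) \<and>
     (\<forall>s\<ge>0. \<forall>t\<ge>0. \<forall>x. S (t + s) x = S t (S s x))"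

definition asymptotically_compact :: "(real \<Rightarrow> 'a::metric_space \<Rightarrow> 'a) \<Rightarrow> bool" where
  "asymptotically_compact S \<longleftrightarrow>
     (\<forall>(x :: nat \<Rightarrow> 'a) (t :: nat \<Rightarrow> real).
        bounded (range x) \<and> (\<forall>n. 0 \<le> t n) \<and> filterlim t at_top sequentially \<and>
        bounded (range (\<lambda>n. S (t n) (x n))) \<longrightarrow>
        (\<exists>(r :: nat \<Rightarrow> nat) y. strict_mono r \<and> (\<lambda>n. S (t (r n)) (x (r n))) \<longlonglongrightarrow> y))"

definition equilibrium :: "(real \<Rightarrow> 'a \<Rightarrow> 'a) \<Rightarrow> 'a \<Rightarrow> bool" where
  "equilibrium S E \<longleftrightarrow> (\<forall>t\<ge>0. S t E = E)"

definition invariant :: "(real \<Rightarrow> 'a \<Rightarrow> 'a) \<Rightarrow> 'a set \<Rightarrow> bool" where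
  "invariant S A \<longleftrightarrow> (\<forall>t\<ge>0. S t ` A = A)"

section \<open>Attractors\<close>

text \<open>The distance to the empty set is read as infinite, whereas \<^term>\<open>infdist x {} = 0\<close>; hence the
  explicit nonemptiness conditions below.\<close>

definition set_ball :: "'a::metric_space set \<Rightarrow> real \<Rightarrow> 'a set" where
  "set_ball A \<epsilon> = {y. A \<noteq> {} \<and> infdist y A < \<epsilon>}"

definition attracts :: "(real \<Rightarrow> 'a::metric_space \<Rightarrow> 'a) \<Rightarrow> 'a set \<Rightarrow> 'a set \<Rightarrow> bool" where
  "attracts S A B \<longleftrightarrow> (\<forall>\<epsilon>>0. \<exists>T>0. \<forall>t>T. S t ` B \<subseteq> set_ball A \<epsilon>)"

text \<open>The phase space \<open>Y\<close> is a parameter: \<open>Y = UNIV\<close> gives the attractors of \<open>S\<close>, and an invariant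
  \<open>Y\<close> gives the attractors of the restriction of \<open>S\<close> to \<open>Y\<close>, where closure and interior are those
  of the subspace \<open>Y\<close>. The balls of \<^const>\<open>set_ball\<close> need not be cut down to \<open>Y\<close>, as \<open>S t\<close> maps
  \<open>Y\<close> into itself.\<close>

definition neighbourhood_in :: "'a::metric_space set \<Rightarrow> 'a set \<Rightarrow> 'a set \<Rightarrow> bool" where
  "neighbourhood_in Y U A \<longleftrightarrow>
     U \<subseteq> Y \<and> (top_of_set Y) closure_of A \<subseteq> (top_of_set Y) interior_of U"

definition attractor_in :: "(real \<Rightarrow> 'a::metric_space \<Rightarrow> 'a) \<Rightarrow> 'a set \<Rightarrow> 'a set \<Rightarrow> bool" where
  "attractor_in S Y A \<longleftrightarrow>
     A \<subseteq> Y \<and> compact A \<and> invariant S A \<and> (\<exists>U. neighbourhood_in Y U A \<and> attracts S A U)"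

abbreviation attractor :: "(real \<Rightarrow> 'a::metric_space \<Rightarrow> 'a) \<Rightarrow> 'a set \<Rightarrow> bool" where
  "attractor S A \<equiv> attractor_in S UNIV A"

definition basin :: "(real \<Rightarrow> 'a::metric_space \<Rightarrow> 'a) \<Rightarrow> 'a set \<Rightarrow> 'a set" where
  "basin S A = {x. A \<noteq> {} \<and> ((\<lambda>t. infdist (S t x) A) \<longlongrightarrow> 0) at_top}"

section \<open>Morse decompositions\<close>

definition omega_limit :: "(real \<Rightarrow> 'a::metric_space \<Rightarrow> 'a) \<Rightarrow> 'a \<Rightarrow> 'a set" where
  "omega_limit S x =
     {y. \<exists>t :: nat \<Rightarrow> real. (\<forall>n. 0 \<le> t n) \<and> filterlim t at_top sequentially \<and>
           (\<lambda>n. S (t n) x) \<longlonglongrightarrow> y}"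

definition dual_repeller ::
    "(real \<Rightarrow> 'a::metric_space \<Rightarrow> 'a) \<Rightarrow> 'a set \<Rightarrow> 'a set \<Rightarrow> 'a set" where
  "dual_repeller S \<A> A = {x \<in> \<A>. omega_limit S x \<inter> A = {}}"

text \<open>The Morse sets are \<open>M 1, \<dots>, M l\<close>; the values of \<open>M\<close> at other indices are irrelevant.\<close>

definition morse_decomposition ::
    "(real \<Rightarrow> 'a::metric_space \<Rightarrow> 'a) \<Rightarrow> 'a set \<Rightarrow> nat \<Rightarrow> (nat \<Rightarrow> 'a set) \<Rightarrow> bool" where
  "morse_decomposition S \<A> l M \<longleftrightarrow>
     (\<exists>A :: nat \<Rightarrow> 'a set.
        A 0 = {} \<and> A l = \<A> \<and>
        (\<forall>k\<in>{0..l}. attractor_in S \<A> (A k)) \<and>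
        (\<forall>k\<in>{1..l}. A (k - 1) \<subset> A k) \<and>
        (\<forall>k\<in>{1..l}. M k = A k \<inter> dual_repeller S \<A> (A (k - 1))))"

section \<open>Morse-Lyapunov functions\<close>

definition morse_lyapunov ::
    "(real \<Rightarrow> 'a::metric_space \<Rightarrow> 'a) \<Rightarrow> 'a set \<Rightarrow> nat \<Rightarrow> (nat \<Rightarrow> 'a set) \<Rightarrow> ('a \<Rightarrow> real) \<Rightarrow> bool" where
  "morse_lyapunov S \<Omega> l M V \<longleftrightarrow>
     continuous_on \<Omega> V \<and>
     (\<forall>k\<in>{1..l}. V constant_on M k) \<and>
     (\<forall>x \<in> \<Omega> - (\<Union>k\<in>{1..l}. M k). monotone_on {0..} (<) (>) (\<lambda>t. V (S t x)))"

text \<open>Morse sets are nonempty, so comparing \<open>V\<close> at arbitrary points of \<open>M i\<close> and \<open>M j\<close> is comparing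
  the constant values of \<open>V\<close> on these sets, and the image of the union of the Morse sets under
  \<open>V\<close> is exactly the set of those constant values.\<close>

definition strict_morse_lyapunov ::
    "(real \<Rightarrow> 'a::metric_space \<Rightarrow> 'a) \<Rightarrow> 'a set \<Rightarrow> nat \<Rightarrow> (nat \<Rightarrow> 'a set) \<Rightarrow> ('a \<Rightarrow> real) \<Rightarrow> bool" where
  "strict_morse_lyapunov S \<Omega> l M V \<longleftrightarrow>
     morse_lyapunov S \<Omega> l M V \<and>
     (\<forall>i\<in>{1..l}. \<forall>j\<in>{1..l}. i < j \<longrightarrow> (\<forall>x\<in>M i. \<forall>y\<in>M j. V x < V y))"

definition critical_values :: "nat \<Rightarrow> (nat \<Rightarrow> 'a set) \<Rightarrow> ('a \<Rightarrow> real) \<Rightarrow> real set" where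
  "critical_values l M V = V ` (\<Union>k\<in>{1..l}. M k)"

definition sublevel :: "'a set \<Rightarrow> ('a \<Rightarrow> real) \<Rightarrow> real \<Rightarrow> 'a set" where
  "sublevel \<Omega> V a = {x \<in> \<Omega>. V x \<le> a}"

section \<open>Strong deformation retracts\<close>

definition strong_deformation_retract :: "'a::topological_space set \<Rightarrow> 'a set \<Rightarrow> bool" where
  "strong_deformation_retract F Y \<longleftrightarrow>
     F \<subseteq> Y \<and>
     (\<exists>H :: real \<Rightarrow> 'a \<Rightarrow> 'a.
        continuous_on ({0..1} \<times> Y) (\<lambda>(\<sigma>, x). H \<sigma> x) \<and>
        (\<forall>\<sigma>\<in>{0..1}. \<forall>x\<in>Y. H \<sigma> x \<in> Y) \<and>
        (\<forall>x\<in>Y. H 0 x = x) \<and>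
        (\<forall>x\<in>Y. H 1 x \<in> F) \<and>
        (\<forall>\<sigma>\<in>{0..1}. \<forall>x\<in>F. H \<sigma> x = x))"

end

theory Submission
  imports Defs
begin

text \<open>Between the levels \<open>c\<close> and \<open>b\<close>, the function \<open>V\<close> strictly decreases along every trajectory
  except the one resting at \<open>E\<close>. Flow a point of \<open>V\<^sub>b\<close> down until it hits the level \<open>c\<close>, after
  compressing the time axis \<open>[0, \<infinity>]\<close> to \<open>[0, 1]\<close>. A trajectory that never crosses below the level
  \<open>c\<close> converges to \<open>E\<close>, so the flow at time \<open>\<infinity>\<close> is taken to be \<open>E\<close>. Continuity amounts to the
  statement that \<open>S(s\<^sub>n)x\<^sub>n \<rightarrow> E\<close> whenever \<open>x\<^sub>n \<rightarrow> x\<close>, \<open>s\<^sub>n \<rightarrow> \<infinity>\<close> and \<open>V(S(s\<^sub>n)x\<^sub>n) \<ge> c\<close>: the limit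
  points \<open>y'\<close> of \<open>S(s\<^sub>n - 1)x\<^sub>n\<close> satisfy \<open>V(y') = c = V(S(1)y')\<close>, so \<open>y' = E\<close>.\<close>

section \<open>Subsequences\<close>

text \<open>Compactness only yields subsequences with a known limit. Without convergence, some
  subsequence stays outside an open neighbourhood of \<open>L\<close>, and none of its subsequences
  can tend to \<open>L\<close>.\<close>

lemma tendsto_if_subseq:
  fixes X :: "nat \<Rightarrow> 'a::topological_space"
  assumes "\<And>r :: nat \<Rightarrow> nat. strict_mono r \<Longrightarrow> \<exists>q :: nat \<Rightarrow> nat. strict_mono q \<and> (\<lambda>n. X (r (q n))) \<longlonglongrightarrow> L"
  shows "X \<longlonglongrightarrow> L"
proof (rule topological_tendstoI, rule ccontr)
  fix U assume U: "open U" "L \<in> U" "\<not> (\<forall>\<^sub>F n in sequentially. X n \<in> U)"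
  then obtain r :: "nat \<Rightarrow> nat" where r: "strict_mono r" "\<And>n. X (r n) \<notin> U"
    using not_eventually_sequentiallyD by blast
  then obtain q where "(\<lambda>n. X (r (q n))) \<longlonglongrightarrow> L"
    using assms by blast
  with U have "\<forall>\<^sub>F n in sequentially. X (r (q n)) \<in> U"
    by (auto dest: topological_tendstoD)
  with r show False
    by simp
qed

lemma tendsto_subseq:
  fixes r :: "nat \<Rightarrow> nat"
  assumes "filterlim X F sequentially" "strict_mono r"
  shows "filterlim (\<lambda>n. X (r n)) F sequentially"
  using filterlim_compose[OF assms(1) filterlim_subseq[OF assms(2)]] .

text \<open>Nearest points \<open>a n\<close> exist in the compact set \<open>A\<close>. A
  subsequence of them converges in \<open>A\<close>, and the \<open>x n\<close> are dragged
  along.\<close>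

lemma infdist_tendsto_0_subseq:
  fixes x :: "nat \<Rightarrow> 'a::metric_space"
  assumes "compact A" "A \<noteq> {}" and lim: "(\<lambda>n. infdist (x n) A) \<longlonglongrightarrow> 0"
  shows "\<exists>r y. strict_mono r \<and> y \<in> A \<and> (\<lambda>n. x (r n)) \<longlonglongrightarrow> y"
proof -
  have "\<exists>a\<in>A. dist (x n) a = infdist (x n) A" for n
  proof -
    obtain a where "a \<in> A" "\<forall>z\<in>A. dist (x n) a \<le> dist (x n) z"
      using continuous_attains_inf[OF assms(1,2) continuous_on_dist[OF continuous_on_const continuous_on_id]]
      by blast
    then have "infdist (x n) A = dist (x n) a"
      by (intro antisym infdist_le) (auto simp: infdist_notempty[OF assms(2)] intro!: cINF_greatest assms(2))
    with \<open>a \<in> A\<close> show ?thesis by auto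
  qed
  then obtain a where a: "\<And>n. a n \<in> A" "\<And>n. dist (x n) (a n) = infdist (x n) A"
    by metis
  obtain y r where r: "y \<in> A" "strict_mono (r :: nat \<Rightarrow> nat)" "(a \<circ> r) \<longlonglongrightarrow> y"
    using assms(1) a(1) unfolding compact_def by metis
  have "(\<lambda>n. dist (x (r n)) (a (r n)) + dist (a (r n)) y) \<longlonglongrightarrow> 0 + 0"
    using tendsto_subseq[OF lim r(2)] r(3) a(2)
    by (intro tendsto_add) (auto simp: tendsto_dist_iff[of _ y] o_def)
  then have "(\<lambda>n. dist (x (r n)) y) \<longlonglongrightarrow> 0"
    by (intro Lim_null_comparison[of "\<lambda>n. dist (x (r n)) y"] always_eventually)
      (auto intro: dist_triangle)
  then have "(\<lambda>n. x (r n)) \<longlonglongrightarrow> y"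
    by (rule tendsto_dist_iff[THEN iffD2])
  with r show ?thesis by blast
qed

section \<open>Long trajectories in the basin\<close>

locale attracted_semiflow =
  fixes S :: "real \<Rightarrow> 'a::metric_space \<Rightarrow> 'a" and A :: "'a set"
  assumes semiflow: "semiflow S"
    and attractor: "attractor S A"
    and A_nonempty: "A \<noteq> {}"
begin

lemma S_0 [simp]: "S 0 x = x"
  using semiflow by (simp add: semiflow_def)

lemma S_add: "0 \<le> s \<Longrightarrow> 0 \<le> t \<Longrightarrow> S (t + s) x = S t (S s x)"
  using semiflow by (simp add: semiflow_def)

lemma S_tendsto:
  assumes "(f \<longlongrightarrow> t) F" "(g \<longlongrightarrow> x) F" "0 \<le> t" "\<forall>\<^sub>F n in F. 0 \<le> f n"
  shows "((\<lambda>n. S (f n) (g n)) \<longlongrightarrow> S t x) F"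
proof -
  have "continuous_on ({0..} \<times> UNIV) (\<lambda>(t, x). S t x)"
    using semiflow by (simp add: semiflow_def)
  from continuous_on_tendsto_compose[OF this tendsto_Pair[OF assms(1,2)]] assms(3,4)
  show ?thesis by simp
qed

lemma S_tendsto_const:
  "(g \<longlongrightarrow> x) F \<Longrightarrow> 0 \<le> t \<Longrightarrow> ((\<lambda>n. S t (g n)) \<longlongrightarrow> S t x) F"
  by (rule S_tendsto) auto

lemma compact_A: "compact A"
  using attractor by (simp add: attractor_in_def)

lemma A_subset_basin: "A \<subseteq> basin S A"
proof
  fix x assume "x \<in> A"
  then have "S t x \<in> A" if "0 \<le> t" for t
    using attractor that by (auto simp: attractor_in_def invariant_def)
  then have "\<forall>\<^sub>F t in at_top. infdist (S t x) A = 0"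
    by (auto intro: eventually_mono[OF eventually_ge_at_top[of 0]])
  then show "x \<in> basin S A"
    using A_nonempty by (simp add: basin_def tendsto_eventually)
qed

lemma S_basin:
  assumes "x \<in> basin S A" "0 \<le> t"
  shows "S t x \<in> basin S A"
proof -
  have "((\<lambda>s. infdist (S (s + t) x) A) \<longlongrightarrow> 0) at_top"
    using assms(1) filterlim_tendsto_add_at_top[OF tendsto_const[of t] filterlim_ident]
    by (auto simp: basin_def add.commute intro: filterlim_compose)
  moreover have "\<forall>\<^sub>F s in at_top. infdist (S (s + t) x) A = infdist (S s (S t x)) A"
    using assms(2) by (auto simp: S_add intro: eventually_mono[OF eventually_ge_at_top[of 0]])
  ultimately have "((\<lambda>s. infdist (S s (S t x)) A) \<longlongrightarrow> 0) at_top"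
    by (rule Lim_transform_eventually)
  then show ?thesis
    using A_nonempty by (simp add: basin_def)
qed

text \<open>Passing to the interior makes membership in \<open>U\<close> stable under small changes
  of the point, while the time \<open>T\<close> remains uniform over \<open>U\<close>.\<close>

lemma attracted_neighbourhood:
  obtains U where "open U" "A \<subseteq> U"
    "\<forall>\<epsilon>>0. \<exists>T>0. \<forall>t>T. \<forall>x\<in>U. infdist (S t x) A < \<epsilon>"
proof -
  obtain U where U: "neighbourhood_in UNIV U A" "attracts S A U"
    using attractor by (auto simp: attractor_in_def)
  show thesis
  proof
    show "A \<subseteq> interior U"
      using U(1) closure_subset by (auto simp: neighbourhood_in_def)
    show "\<forall>\<epsilon>>0. \<exists>T>0. \<forall>t>T. \<forall>x\<in>interior U. infdist (S t x) A < \<epsilon>"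
    proof (intro allI impI)
      fix \<epsilon> :: real assume "0 < \<epsilon>"
      then obtain T where "T > 0" "\<forall>t>T. S t ` U \<subseteq> set_ball A \<epsilon>"
        using U(2) by (auto simp: attracts_def)
      then show "\<exists>T>0. \<forall>t>T. \<forall>x\<in>interior U. infdist (S t x) A < \<epsilon>"
        using interior_subset by (fastforce simp: set_ball_def)
    qed
  qed simp
qed

text \<open>Attraction is locally uniform in the initial point. The orbit of \<open>x0\<close>
  enters \<open>U\<close> at some time \<open>k\<close>; by continuity of \<open>S k\<close> so do
  nearby orbits, and from then on the uniform attraction of \<open>U\<close> applies.\<close>

lemma infdist_tendsto_0:
  assumes "x \<longlonglongrightarrow> x0" "x0 \<in> basin S A" and s: "filterlim s at_top sequentially"
  shows "(\<lambda>n. infdist (S (s n) (x n)) A) \<longlonglongrightarrow> 0"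
proof -
  obtain U where U: "open U" "A \<subseteq> U"
    "\<forall>\<epsilon>>0. \<exists>T>0. \<forall>t>T. \<forall>x\<in>U. infdist (S t x) A < \<epsilon>"
    by (rule attracted_neighbourhood)
  have "(\<lambda>n. infdist (S (real n) x0) A) \<longlonglongrightarrow> 0"
    using assms(2) filterlim_real_sequentially by (auto simp: basin_def intro: filterlim_compose)
  from infdist_tendsto_0_subseq[OF compact_A A_nonempty this]
  obtain r y where "y \<in> A" "(\<lambda>n. S (real (r n)) x0) \<longlonglongrightarrow> y"
    by auto
  with U(1,2) have "\<forall>\<^sub>F n in sequentially. S (real (r n)) x0 \<in> U"
    by (intro topological_tendstoD) auto
  then obtain k :: nat where k: "S (real k) x0 \<in> U"
    by (auto simp: eventually_sequentially)
  have "(\<lambda>n. S (real k) (x n)) \<longlonglongrightarrow> S (real k) x0"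
    using assms(1) by (rule S_tendsto_const) simp
  then have ev: "\<forall>\<^sub>F n in sequentially. S (real k) (x n) \<in> U"
    using U(1) k by (intro topological_tendstoD)
  show ?thesis
  proof (rule tendstoI)
    fix \<epsilon> :: real assume "0 < \<epsilon>"
    then obtain T where T: "T > 0" "\<forall>t>T. \<forall>x\<in>U. infdist (S t x) A < \<epsilon>"
      using U(3) by blast
    have "\<forall>\<^sub>F n in sequentially. s n > T + k"
      using s by (simp add: filterlim_at_top_dense)
    with ev show "\<forall>\<^sub>F n in sequentially. dist (infdist (S (s n) (x n)) A) 0 < \<epsilon>"
    proof eventually_elim
      case (elim n)
      then have "S (s n) (x n) = S (s n - k) (S k (x n))"
        using T(1) S_add[of "real k" "s n - k"] by simp
      with elim T show ?case
        by (auto simp: infdist_nonneg)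
    qed
  qed
qed

text \<open>Source of all limit points of trajectories below: the compactness of
  \<open>A\<close>.\<close>

lemma orbit_subseq:
  assumes "x \<longlonglongrightarrow> x0" "x0 \<in> basin S A" "filterlim s at_top sequentially"
  obtains r y where "strict_mono (r :: nat \<Rightarrow> nat)" "y \<in> A" "(\<lambda>n. S (s (r n)) (x (r n))) \<longlonglongrightarrow> y"
proof -
  from infdist_tendsto_0_subseq[OF compact_A A_nonempty infdist_tendsto_0[OF assms]]
  show thesis by (elim exE conjE) (rule that)
qed

end

section \<open>Descent to a critical level\<close>

text \<open>\<open>V_descent\<close> constrains only the starting point to the strip between the
  levels; the descent then holds for all later times, even below \<open>c\<close>.\<close>

locale descending_semiflow = attracted_semiflow S A
  for S :: "real \<Rightarrow> 'a::metric_space \<Rightarrow> 'a" and A :: "'a set" +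
  fixes V :: "'a \<Rightarrow> real" and E :: 'a and b c :: real
  assumes E_in_A: "E \<in> A"
    and E_equilibrium: "equilibrium S E"
    and V_E [simp]: "V E = c"
    and c_le_b: "c \<le> b"
    and V_continuous: "continuous_on (basin S A) V"
    and V_descent: "\<And>x. \<lbrakk>x \<in> basin S A; c \<le> V x; V x \<le> b; x \<noteq> E\<rbrakk>
          \<Longrightarrow> monotone_on {0..} (<) (>) (\<lambda>t. V (S t x))"
begin

definition Z :: "'a set" where
  "Z = {x \<in> basin S A. c \<le> V x \<and> V x \<le> b}"

lemma S_E [simp]: "0 \<le> t \<Longrightarrow> S t E = E"
  using E_equilibrium by (simp add: equilibrium_def)

lemma E_basin: "E \<in> basin S A"
  using E_in_A A_subset_basin by blast

lemma S_Z_basin: "x \<in> Z \<Longrightarrow> 0 \<le> t \<Longrightarrow> S t x \<in> basin S A"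
  by (simp add: Z_def S_basin)

lemma V_strict:
  assumes "x \<in> Z" "x \<noteq> E" "0 \<le> s" "s < t"
  shows "V (S t x) < V (S s x)"
  using assms V_descent[of x] by (auto simp: Z_def monotone_on_def)

lemma V_antimono:
  assumes "x \<in> Z" "0 \<le> s" "s \<le> t"
  shows "V (S t x) \<le> V (S s x)"
  using assms V_strict[of x s t] by (cases "x = E"; cases "s = t") auto

lemma V_le_initial: "x \<in> Z \<Longrightarrow> 0 \<le> t \<Longrightarrow> V (S t x) \<le> V x"
  using V_antimono[of x 0 t] by simp

lemma V_tendsto:
  assumes "(f \<longlongrightarrow> y) F" "y \<in> basin S A" "\<forall>\<^sub>F n in F. f n \<in> basin S A"
  shows "((\<lambda>n. V (f n)) \<longlongrightarrow> V y) F"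
  using continuous_on_tendsto_compose[OF V_continuous assms] .

lemma V_S_tendsto:
  assumes "(f \<longlongrightarrow> t) F" "(g \<longlongrightarrow> x) F" "0 \<le> t" "\<forall>\<^sub>F n in F. 0 \<le> f n"
    and "x \<in> Z" "\<forall>\<^sub>F n in F. g n \<in> Z"
  shows "((\<lambda>n. V (S (f n) (g n))) \<longlongrightarrow> V (S t x)) F"
proof (rule V_tendsto[OF S_tendsto[OF assms(1-4)]])
  show "\<forall>\<^sub>F n in F. S (f n) (g n) \<in> basin S A"
    using assms(4,6) by eventually_elim (rule S_Z_basin)
qed (rule S_Z_basin[OF assms(5,3)])

text \<open>The form in which strict descent identifies limit points: one unit of time already
  lowers \<open>V\<close> everywhere in \<open>Z\<close> except at \<open>E\<close>.\<close>

lemma eq_E_if_not_descending: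
  assumes "y \<in> Z" "V y \<le> V (S 1 y)"
  shows "y = E"
  using V_strict[of y 0 1] assms by force

text \<open>LaSalle's principle: \<open>V\<close> never falls below \<open>V y\<close> along the
  trajectory. Since \<open>S 1 y\<close> is a limit of later points of it, \<open>V (S 1 y)\<close>
  is not below \<open>V y\<close> either.\<close>

lemma limit_point_above_level:
  assumes x: "x \<in> Z" and above: "\<And>t. 0 \<le> t \<Longrightarrow> c \<le> V (S t x)"
    and r: "filterlim r at_top sequentially" and lim: "(\<lambda>n. S (r n) x) \<longlonglongrightarrow> y" and y: "y \<in> A"
  shows "y = E"
proof -
  have yb: "y \<in> basin S A"
    using y A_subset_basin by blast
  have r0: "\<forall>\<^sub>F n in sequentially. r n \<ge> t" for t
    using r by (simp add: filterlim_at_top)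
  have "\<forall>\<^sub>F n in sequentially. S (r n) x \<in> basin S A"
    using r0[of 0] by eventually_elim (rule S_Z_basin[OF x])
  from V_tendsto[OF lim yb this] have V: "(\<lambda>n. V (S (r n) x)) \<longlonglongrightarrow> V y" .
  have le: "V y \<le> V (S t x)" if "0 \<le> t" for t
    using V
  proof (rule tendsto_upperbound)
    show "\<forall>\<^sub>F n in sequentially. V (S (r n) x) \<le> V (S t x)"
      using r0[of t] by eventually_elim (use V_antimono[OF x that] in auto)
  qed simp
  have "c \<le> V y"
    using V
  proof (rule tendsto_lowerbound)
    show "\<forall>\<^sub>F n in sequentially. c \<le> V (S (r n) x)"
      using r0[of 0] by eventually_elim (rule above)
  qed simp
  then have yZ: "y \<in> Z"
    using le[of 0] x yb by (auto simp: Z_def)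
  have "(\<lambda>n. V (S 1 (S (r n) x))) \<longlonglongrightarrow> V (S 1 y)"
  proof (rule V_tendsto[OF S_tendsto_const[OF lim]])
    show "\<forall>\<^sub>F n in sequentially. S 1 (S (r n) x) \<in> basin S A"
      using r0[of 0] by eventually_elim (simp add: S_basin S_Z_basin x)
  qed (auto intro: S_basin yb)
  then have "V y \<le> V (S 1 y)"
  proof (rule tendsto_lowerbound)
    show "\<forall>\<^sub>F n in sequentially. V y \<le> V (S 1 (S (r n) x))"
      using r0[of 0] by eventually_elim (simp add: S_add[symmetric] le)
  qed simp
  then show ?thesis
    using yZ by (rule eq_E_if_not_descending[rotated])
qed

text \<open>Here the initial points vary, so the limit point need not lie on one trajectory. Its
  height is pinned to \<open>c\<close> by comparison with the trajectory of
  \<open>x0\<close>.\<close>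

lemma long_orbit_tendsto_E_subseq:
  assumes xn: "\<And>n. x n \<in> Z" and x0: "x0 \<in> Z" and lim: "x \<longlonglongrightarrow> x0"
    and s: "filterlim s at_top sequentially" and above: "\<And>n. c \<le> V (S (s n) (x n))"
  shows "\<exists>q :: nat \<Rightarrow> nat. strict_mono q \<and> (\<lambda>n. S (s (q n)) (x (q n))) \<longlonglongrightarrow> E"
proof -
  have x0b: "x0 \<in> basin S A"
    using x0 by (simp add: Z_def)
  have s0: "\<forall>\<^sub>F n in sequentially. s n \<ge> t" for t
    using s by (simp add: filterlim_at_top)
  have V_lim: "(\<lambda>n. V (S t (x n))) \<longlonglongrightarrow> V (S t x0)" if "0 \<le> t" for t
    using that xn x0 lim by (intro V_S_tendsto) auto
  \<comment> \<open>For fixed \<open>t\<close> eventually \<open>t \<le> s n\<close>, so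
    \<open>x n\<close> is still above the level at time \<open>t\<close>; this passes to the
    limit.\<close>
  have above0: "c \<le> V (S t x0)" if "0 \<le> t" for t
    using V_lim[OF that]
  proof (rule tendsto_lowerbound)
    show "\<forall>\<^sub>F n in sequentially. c \<le> V (S t (x n))"
      using s0[of t]
    proof eventually_elim
      case (elim n)
      then show ?case
        using V_antimono[OF xn that elim, of n] above[of n] by linarith
    qed
  qed simp
  \<comment> \<open>Backing up by one unit makes \<open>S 1 y\<close> a limit of the points at time
    \<open>s\<close>, which are known to be no lower than \<open>c\<close>.\<close>
  have s': "filterlim (\<lambda>n. s n - 1) at_top sequentially"
    using filterlim_tendsto_add_at_top[OF tendsto_const[of "-1"] s] by simp
  obtain q y where q: "strict_mono q" and y: "y \<in> A"
    and y_lim: "(\<lambda>n. S (s (q n) - 1) (x (q n))) \<longlonglongrightarrow> y"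
    using orbit_subseq[OF lim x0b s'] .
  have yb: "y \<in> basin S A"
    using y A_subset_basin by blast
  have sq: "\<forall>\<^sub>F n in sequentially. s (q n) \<ge> t" for t
    using tendsto_subseq[OF s q] by (simp add: filterlim_at_top)
  have "\<forall>\<^sub>F n in sequentially. S (s (q n) - 1) (x (q n)) \<in> basin S A"
    using sq[of 1] by eventually_elim (auto intro!: S_Z_basin xn)
  from V_tendsto[OF y_lim yb this]
  have V: "(\<lambda>n. V (S (s (q n) - 1) (x (q n)))) \<longlonglongrightarrow> V y" .
  have V_y_le: "V y \<le> V (S t x0)" if "0 \<le> t" for t
  proof (rule tendsto_le[OF _ tendsto_subseq[OF V_lim[OF that] q] V])
    show "\<forall>\<^sub>F n in sequentially. V (S (s (q n) - 1) (x (q n))) \<le> V (S t (x (q n)))"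
      using sq[of "t + 1"] by eventually_elim (auto intro!: V_antimono xn that)
  qed simp
  \<comment> \<open>The trajectory of \<open>x0\<close> stays above the level, so along a
    subsequence it tends to \<open>E\<close>; its heights bound \<open>V y\<close> and tend to
    \<open>c\<close>.\<close>
  obtain r z where r: "strict_mono r" and z: "z \<in> A" and z_lim: "(\<lambda>n. S (real (r n)) x0) \<longlonglongrightarrow> z"
    using orbit_subseq[OF tendsto_const x0b filterlim_real_sequentially] .
  have "z = E"
    using limit_point_above_level[OF x0 above0 _ z_lim z]
      tendsto_subseq[OF filterlim_real_sequentially r] by blast
  with z_lim have "(\<lambda>n. V (S (real (r n)) x0)) \<longlonglongrightarrow> V E"
    by (intro V_tendsto) (simp_all add: S_Z_basin x0 E_basin)
  then have "V y \<le> c"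
    using V_y_le by (auto intro: tendsto_lowerbound)
  moreover have "c \<le> V y"
    using V
  proof (rule tendsto_lowerbound)
    show "\<forall>\<^sub>F n in sequentially. c \<le> V (S (s (q n) - 1) (x (q n)))"
      using sq[of 1]
    proof eventually_elim
      case (elim n)
      then show ?case
        using V_antimono[OF xn, of "s (q n) - 1" "s (q n)" "q n"] above[of "q n"] by linarith
    qed
  qed simp
  ultimately have "V y = c" "y \<in> Z"
    using yb c_le_b by (auto simp: Z_def)
  have "(\<lambda>n. S 1 (S (s (q n) - 1) (x (q n)))) \<longlonglongrightarrow> S 1 y"
    using y_lim by (rule S_tendsto_const) simp
  moreover have "\<forall>\<^sub>F n in sequentially. S 1 (S (s (q n) - 1) (x (q n))) = S (s (q n)) (x (q n))"
    using sq[of 1] by eventually_elim (simp add: S_add[symmetric])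
  ultimately have S1_lim: "(\<lambda>n. S (s (q n)) (x (q n))) \<longlonglongrightarrow> S 1 y"
    by (rule Lim_transform_eventually)
  have "\<forall>\<^sub>F n in sequentially. S (s (q n)) (x (q n)) \<in> basin S A"
    using sq[of 0] by eventually_elim (auto intro!: S_Z_basin xn)
  from V_tendsto[OF S1_lim S_basin[OF yb] this]
  have "(\<lambda>n. V (S (s (q n)) (x (q n)))) \<longlonglongrightarrow> V (S 1 y)" by simp
  then have "c \<le> V (S 1 y)"
    using above by (auto intro: tendsto_lowerbound)
  then have "y = E"
    using \<open>V y = c\<close> \<open>y \<in> Z\<close> by (auto intro: eq_E_if_not_descending)
  then show ?thesis
    using S1_lim q by auto
qed

lemma long_orbit_tendsto_E:
  assumes "\<And>n. x n \<in> Z" "x0 \<in> Z" "x \<longlonglongrightarrow> x0"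
    and "filterlim s at_top sequentially" "\<And>n. c \<le> V (S (s n) (x n))"
  shows "(\<lambda>n. S (s n) (x n)) \<longlonglongrightarrow> E"
proof (rule tendsto_if_subseq)
  fix r :: "nat \<Rightarrow> nat" assume r: "strict_mono r"
  show "\<exists>q :: nat \<Rightarrow> nat. strict_mono q \<and> (\<lambda>n. S (s (r (q n))) (x (r (q n)))) \<longlonglongrightarrow> E"
    using assms(1,2) tendsto_subseq[OF assms(3) r] tendsto_subseq[OF assms(4) r] assms(5)
    by (rule long_orbit_tendsto_E_subseq)
qed

section \<open>Stopping at the critical level\<close>

text \<open>The last time at height at least \<open>c\<close>, infinite if the trajectory never
  sinks below \<open>c\<close>. In \<open>Z\<close> it differs from the first arrival at level
  \<open>c\<close> only at \<open>E\<close>, where it is infinite, and for trajectories that never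
  arrive there is no such time.\<close>

definition hit :: "'a \<Rightarrow> ereal" where
  "hit x = Sup {ereal t | t. 0 \<le> t \<and> c \<le> V (S t x)}"

text \<open>The value \<open>E\<close> at infinite time is the true limit only for trajectories that
  never sink below \<open>c\<close>; the deformation therefore caps the time by
  \<open>hit x\<close>.\<close>

definition run :: "ereal \<Rightarrow> 'a \<Rightarrow> 'a" where
  "run e x = (if e = \<infinity> then E else S (real_of_ereal e) x)"

lemma hit_ge: "0 \<le> t \<Longrightarrow> c \<le> V (S t x) \<Longrightarrow> ereal t \<le> hit x"
  unfolding hit_def by (rule Sup_upper) auto

lemma hit_nonneg: "x \<in> Z \<Longrightarrow> 0 \<le> hit x"
  using hit_ge[of 0 x] by (simp add: Z_def zero_ereal_def)

lemma less_hitE: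
  assumes "a < hit x"
  obtains t where "0 \<le> t" "a < ereal t" "c \<le> V (S t x)"
  using assms unfolding hit_def less_Sup_iff by auto

text \<open>Any earlier time is followed by one at height at least \<open>c\<close>, and descent
  carries the bound back; the endpoint is a limit from the left. Time 0 is separate because
  \<open>S\<close> is unconstrained at negative times.\<close>

lemma above_before_hit:
  assumes x: "x \<in> Z" and t: "0 \<le> t" "ereal t \<le> hit x"
  shows "c \<le> V (S t x)"
proof (cases "t = 0")
  case True
  then show ?thesis using x by (simp add: Z_def)
next
  case False
  have above: "c \<le> V (S s x)" if s: "0 < s" "s < t" for s
  proof -
    have "ereal s < hit x"
      using s(2) t(2) by (metis less_le_trans less_ereal.simps(1))
    then obtain u where "0 \<le> u" "ereal s < ereal u" "c \<le> V (S u x)"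
      by (rule less_hitE)
    then show ?thesis
      using V_antimono[OF x, of s u] s by simp
  qed
  have ev: "\<forall>\<^sub>F s in at_left t. 0 < s \<and> s < t"
    using False t(1) by (intro eventually_at_leftI[of 0]) auto
  have "((\<lambda>s. V (S s x)) \<longlongrightarrow> V (S t x)) (at_left t)"
    by (rule V_S_tendsto) (use ev x t(1) in \<open>auto elim: eventually_mono\<close>)
  then show ?thesis
    by (rule tendsto_lowerbound) (use ev above in \<open>auto elim: eventually_mono\<close>)
qed

lemma below_after_hit: "0 \<le> t \<Longrightarrow> hit x < ereal t \<Longrightarrow> V (S t x) < c"
  using hit_ge[of t x] by force

text \<open>After the hitting time \<open>V\<close> is below \<open>c\<close>, so the bound follows
  by a limit from the right.\<close>

lemma V_at_hit:
  assumes x: "x \<in> Z" and t: "hit x = ereal t"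
  shows "V (S t x) \<le> c"
proof -
  have "0 \<le> t"
    using hit_nonneg[OF x] t by simp
  have ev: "\<forall>\<^sub>F s in at_right t. t < s"
    by (simp add: eventually_at_right_less)
  have "((\<lambda>s. V (S s x)) \<longlongrightarrow> V (S t x)) (at_right t)"
    by (rule V_S_tendsto) (use ev x \<open>0 \<le> t\<close> in \<open>auto elim: eventually_mono\<close>)
  then show ?thesis
  proof (rule tendsto_upperbound)
    show "\<forall>\<^sub>F s in at_right t. V (S s x) \<le> c"
      using ev by eventually_elim (use below_after_hit[of _ x] t \<open>0 \<le> t\<close> in \<open>auto intro: less_imp_le\<close>)
  qed simp
qed

text \<open>Each bound on \<open>hit x0\<close> is witnessed by a strict inequality for
  \<open>V\<close> at one fixed time, which persists for nearby points.\<close>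

lemma hit_tendsto:
  assumes xn: "\<And>n. x n \<in> Z" and x0: "x0 \<in> Z" "x0 \<noteq> E" and lim: "x \<longlonglongrightarrow> x0"
  shows "(\<lambda>n. hit (x n)) \<longlonglongrightarrow> hit x0"
proof (rule order_tendstoI)
  have V_lim: "(\<lambda>n. V (S t (x n))) \<longlonglongrightarrow> V (S t x0)" if "0 \<le> t" for t
    using that xn x0 lim by (intro V_S_tendsto) auto
  {
    fix a assume a: "a < hit x0"
    show "\<forall>\<^sub>F n in sequentially. a < hit (x n)"
    proof (cases "a < 0")
      case True
      then show ?thesis
        using hit_nonneg[OF xn] by (auto intro!: always_eventually less_le_trans[of a 0])
    next
      case False
      obtain t where t: "0 \<le> t" "a < ereal t" "c \<le> V (S t x0)"
        using a by (rule less_hitE)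
      \<comment> \<open>At time \<open>t\<close> the height may be exactly \<open>c\<close>, which
        is not stable. At the earlier time \<open>u\<close> it exceeds \<open>c\<close> by strict
        descent, and this uses \<open>x0 \<noteq> E\<close>.\<close>
      obtain u where u: "a < ereal u" "ereal u < ereal t"
        using ereal_dense2[OF t(2)] by blast
      have "0 \<le> u"
        using False u(1) by (metis ereal_less_eq(5) less_imp_le linorder_not_less order_trans)
      have "c < V (S u x0)"
        using V_strict[OF x0 \<open>0 \<le> u\<close>, of t] t(3) u(2) by simp
      with V_lim[OF \<open>0 \<le> u\<close>] have "\<forall>\<^sub>F n in sequentially. c < V (S u (x n))"
        by (rule order_tendstoD)
      then show ?thesis
        by eventually_elim (use u(1) hit_ge[OF \<open>0 \<le> u\<close>] in \<open>meson less_imp_le less_le_trans\<close>)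
    qed
  next
    fix a assume a: "hit x0 < a"
    obtain t where t: "hit x0 < ereal t" "ereal t < a"
      using ereal_dense2[OF a] by blast
    have "0 \<le> t"
      using hit_nonneg[OF x0(1)] t(1) by (metis ereal_less_eq(5) less_imp_le order_trans)
    then have "V (S t x0) < c"
      using t(1) by (rule below_after_hit)
    with V_lim[OF \<open>0 \<le> t\<close>] have "\<forall>\<^sub>F n in sequentially. V (S t (x n)) < c"
      by (rule order_tendstoD)
    then show "\<forall>\<^sub>F n in sequentially. hit (x n) < a"
    proof eventually_elim
      case (elim n)
      then have "\<not> ereal t \<le> hit (x n)"
        using above_before_hit[OF xn \<open>0 \<le> t\<close>] by fastforce
      with t(2) show ?case by simp
    qed
  }
qed

lemma hit_at_level: "x \<in> Z \<Longrightarrow> V x = c \<Longrightarrow> x \<noteq> E \<Longrightarrow> hit x = 0"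
proof (rule antisym)
  assume x: "x \<in> Z" "V x = c" "x \<noteq> E"
  then show "0 \<le> hit x"
    by (simp add: hit_nonneg)
  have "t \<le> 0" if "c \<le> V (S t x)" "0 \<le> t" for t
    using V_strict[of x 0 t] x that by force
  then show "hit x \<le> 0"
    unfolding hit_def by (auto intro!: Sup_least)
qed

section \<open>Continuity of the flow up to extended times\<close>

lemma run_0 [simp]: "run 0 x = x"
  by (simp add: run_def)

lemma run_E [simp]: "0 \<le> e \<Longrightarrow> run e E = E"
  by (simp add: run_def real_of_ereal_pos)

lemma run_in_basin:
  assumes "x \<in> Z" "0 \<le> e"
  shows "run e x \<in> basin S A"
  using E_basin S_Z_basin[OF assms(1) real_of_ereal_pos[OF assms(2)]] by (simp add: run_def)

lemma V_run_le:
  assumes x: "x \<in> Z" and "0 \<le> e"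
  shows "V (run e x) \<le> V x"
proof (cases "e = \<infinity>")
  case True
  then show ?thesis using x by (simp add: run_def Z_def)
next
  case False
  then show ?thesis
    using V_le_initial[OF x real_of_ereal_pos[OF \<open>0 \<le> e\<close>]] by (simp add: run_def)
qed

lemma V_run_hit:
  assumes "x \<in> Z"
  shows "V (run (hit x) x) \<le> c"
  using V_at_hit[OF assms] hit_nonneg[OF assms] by (cases "hit x") (auto simp: run_def)

text \<open>For an infinite limit time this is the convergence of long orbits to \<open>E\<close>;
  for a finite one it is joint continuity of the semiflow.\<close>

lemma run_tendsto:
  assumes xn: "\<And>n. x n \<in> Z" and x0: "x0 \<in> Z" and lim: "x \<longlonglongrightarrow> x0"
    and e: "\<And>n. 0 \<le> e n" "\<And>n. e n \<le> hit (x n)" and e_lim: "e \<longlonglongrightarrow> e0"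
  shows "(\<lambda>n. run (e n) (x n)) \<longlonglongrightarrow> run e0 x0"
proof (cases "e0 = \<infinity>")
  case True
  \<comment> \<open>Where \<open>e n\<close> is infinite, \<open>run\<close> is already
    \<open>E\<close> and any time will do; \<open>real n\<close> keeps \<open>s\<close> tending to
    infinity.\<close>
  define s where "s = (\<lambda>n. if e n = \<infinity> then real n else real_of_ereal (e n))"
  have s_le: "ereal (s n) \<le> e n" and s_pos: "0 \<le> s n" for n
    using e(1)[of n] by (cases "e n"; simp add: s_def)+
  have "filterlim s at_top sequentially"
    unfolding filterlim_at_top
  proof
    fix K
    have "\<forall>\<^sub>F n in sequentially. ereal K < e n"
      using e_lim True by (simp add: order_tendstoD)
    moreover have "\<forall>\<^sub>F n in sequentially. K \<le> real n"
      using filterlim_real_sequentially by (simp add: filterlim_at_top)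
    ultimately show "\<forall>\<^sub>F n in sequentially. K \<le> s n"
    proof eventually_elim
      case (elim n)
      then show ?case by (cases "e n") (auto simp: s_def)
    qed
  qed
  then have "(\<lambda>n. S (s n) (x n)) \<longlonglongrightarrow> E"
  proof (rule long_orbit_tendsto_E[OF xn x0 lim])
    show "c \<le> V (S (s n) (x n))" for n
      using above_before_hit[OF xn s_pos order_trans[OF s_le e(2)]] .
  qed
  then have "(\<lambda>n. dist (S (s n) (x n)) E) \<longlonglongrightarrow> 0"
    by (rule tendsto_dist_iff[THEN iffD1])
  \<comment> \<open>Termwise, the distance to \<open>E\<close> is either 0 or the one at time
    \<open>s n\<close>.\<close>
  then have "(\<lambda>n. dist (run (e n) (x n)) E) \<longlonglongrightarrow> 0"
    by (rule Lim_null_comparison[rotated]) (auto simp: run_def s_def)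
  with True show ?thesis
    by (simp add: run_def tendsto_dist_iff[of _ E])
next
  case False
  have "0 \<le> e0"
    using e_lim e(1) by (auto intro: LIMSEQ_le_const)
  with False obtain t where t: "e0 = ereal t" "0 \<le> t"
    by (cases e0) auto
  have "(\<lambda>n. S (real_of_ereal (e n)) (x n)) \<longlonglongrightarrow> S t x0"
    using e_lim t e(1) by (intro S_tendsto lim lim_real_of_ereal) (auto simp: real_of_ereal_pos)
  moreover have "\<forall>\<^sub>F n in sequentially. e n < \<infinity>"
    using order_tendstoD(2)[OF e_lim, of \<infinity>] t by simp
  then have "\<forall>\<^sub>F n in sequentially. S (real_of_ereal (e n)) (x n) = run (e n) (x n)"
    by eventually_elim (simp add: run_def)
  ultimately have "(\<lambda>n. run (e n) (x n)) \<longlonglongrightarrow> S t x0"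
    by (rule Lim_transform_eventually)
  then show ?thesis
    by (simp add: run_def t)
qed

text \<open>At \<open>E\<close> the hitting time is infinite but not continuous, so there the compactness of the
  extended time axis has to replace the convergence of the hitting times.\<close>

lemma run_min_hit_tendsto:
  assumes xn: "\<And>n. x n \<in> Z" and x0: "x0 \<in> Z" and lim: "x \<longlonglongrightarrow> x0"
    and e: "\<And>n. 0 \<le> e n" and e_lim: "e \<longlonglongrightarrow> e0"
  shows "(\<lambda>n. run (min (e n) (hit (x n))) (x n)) \<longlonglongrightarrow> run (min e0 (hit x0)) x0"
proof (cases "x0 = E")
  case False
  then have "(\<lambda>n. min (e n) (hit (x n))) \<longlonglongrightarrow> min e0 (hit x0)"
    using tendsto_min[OF e_lim hit_tendsto[OF xn x0 _ lim]] by blast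
  moreover have "0 \<le> min (e n) (hit (x n))" "min (e n) (hit (x n)) \<le> hit (x n)" for n
    using e hit_nonneg[OF xn] by simp_all
  ultimately show ?thesis
    by (intro run_tendsto[OF xn x0 lim])
next
  case True
  have "0 \<le> e0"
    by (rule LIMSEQ_le_const[OF e_lim]) (simp add: e)
  then have E: "run (min e0 (hit x0)) x0 = E"
    using True hit_nonneg[OF x0] by simp
  show ?thesis
    unfolding E
  proof (rule tendsto_if_subseq)
    fix r :: "nat \<Rightarrow> nat" assume r: "strict_mono r"
    define d where "d = (\<lambda>n. min (e (r n)) (hit (x (r n))))"
    obtain d0 q where q: "strict_mono q" "(d \<circ> q) \<longlonglongrightarrow> d0"
      using compact_complete_linorder[of d] by blast
    have d: "0 \<le> d n" "d n \<le> hit (x (r n))" for n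
      using e hit_nonneg[OF xn] by (auto simp: d_def)
    have "0 \<le> d0"
      by (rule LIMSEQ_le_const[OF q(2)]) (simp add: d(1))
    \<comment> \<open>The limit time \<open>d0\<close> may depend on the subsequence, but
      \<open>run d0 E = E\<close> whatever it is.\<close>
    have "(\<lambda>n. run (d (q n)) (x (r (q n)))) \<longlonglongrightarrow> run d0 x0"
    proof (rule run_tendsto[OF xn x0])
      show "(\<lambda>n. x (r (q n))) \<longlonglongrightarrow> x0"
        using tendsto_subseq[OF tendsto_subseq[OF lim r] q(1)] .
    qed (use q(2) d in \<open>auto simp: o_def\<close>)
    then show "\<exists>q :: nat \<Rightarrow> nat. strict_mono q \<and>
        (\<lambda>n. run (min (e (r (q n))) (hit (x (r (q n))))) (x (r (q n)))) \<longlonglongrightarrow> E"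
      unfolding True run_E[OF \<open>0 \<le> d0\<close>] d_def using q(1) by blast
  qed
qed

end

section \<open>The deformation\<close>

text \<open>On \<open>{0..1}\<close> an increasing homeomorphism onto the extended half-line.
  Testing \<open>1 \<le> \<sigma>\<close> rather than equality lets \<open>clock_tendsto\<close>
  hold for \<open>f\<close> overshooting 1.\<close>

definition clock :: "real \<Rightarrow> ereal" where
  "clock \<sigma> = (if 1 \<le> \<sigma> then \<infinity> else ereal (\<sigma> / (1 - \<sigma>)))"

lemma clock_0 [simp]: "clock 0 = 0" and clock_1 [simp]: "clock 1 = \<infinity>"
  by (simp_all add: clock_def)

lemma clock_nonneg: "0 \<le> \<sigma> \<Longrightarrow> 0 \<le> clock \<sigma>"
  by (simp add: clock_def)

lemma clock_tendsto:
  assumes f: "(f \<longlongrightarrow> \<sigma>) F" and "\<sigma> \<le> 1"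
  shows "((\<lambda>n. clock (f n)) \<longlongrightarrow> clock \<sigma>) F"
proof (cases "\<sigma> = 1")
  case True
  \<comment> \<open>The inequality \<open>r < f n / (1 - f n)\<close> with its denominator cleared;
    the limit is 1.\<close>
  have "((\<lambda>n. f n - r * (1 - f n)) \<longlongrightarrow> \<sigma> - r * (1 - \<sigma>)) F" for r
    by (intro tendsto_diff tendsto_mult tendsto_const f)
  then have ev: "\<forall>\<^sub>F n in F. 0 < f n - r * (1 - f n)" for r
    by (rule order_tendstoD) (simp add: True)
  have "\<forall>\<^sub>F n in F. ereal r < clock (f n)" for r
    using ev[of r] by eventually_elim (auto simp: clock_def less_divide_eq)
  with True show ?thesis
    by (simp add: tendsto_PInfty)
next
  case False
  with assms have "\<sigma> < 1" by simp
  have "((\<lambda>n. ereal (f n / (1 - f n))) \<longlongrightarrow> ereal (\<sigma> / (1 - \<sigma>))) F"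
    using False by (intro tendsto_ereal tendsto_divide tendsto_diff tendsto_const f) simp
  moreover have "\<forall>\<^sub>F n in F. ereal (f n / (1 - f n)) = clock (f n)"
    using order_tendstoD(2)[OF f \<open>\<sigma> < 1\<close>] by eventually_elim (simp add: clock_def)
  ultimately have "((\<lambda>n. clock (f n)) \<longlongrightarrow> ereal (\<sigma> / (1 - \<sigma>))) F"
    by (rule Lim_transform_eventually)
  then show ?thesis
    using \<open>\<sigma> < 1\<close> by (simp add: clock_def)
qed

context descending_semiflow
begin

text \<open>Points below the level are held fixed; the locale gives descent only from the strip. The
  two cases agree at level \<open>c\<close> by \<open>run_at_level\<close>.\<close>

definition deform :: "real \<Rightarrow> 'a \<Rightarrow> 'a" where
  "deform \<sigma> x = (if V x \<le> c then x else run (min (clock \<sigma>) (hit x)) x)"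

lemma continuous_on_run_Z:
  "continuous_on ({0..1} \<times> Z) (\<lambda>(\<sigma>, x). run (min (clock \<sigma>) (hit x)) x)"
proof (rule continuous_on_sequentiallyI)
  fix u and p :: "real \<times> 'a"
  assume u: "\<forall>n. u n \<in> {0..1} \<times> Z" and p: "p \<in> {0..1} \<times> Z" and lim: "u \<longlonglongrightarrow> p"
  then have "(\<lambda>n. clock (fst (u n))) \<longlonglongrightarrow> clock (fst p)"
    by (intro clock_tendsto tendsto_fst) auto
  with u p lim have "(\<lambda>n. run (min (clock (fst (u n))) (hit (snd (u n)))) (snd (u n)))
      \<longlonglongrightarrow> run (min (clock (fst p)) (hit (snd p))) (snd p)"
    by (intro run_min_hit_tendsto tendsto_snd clock_nonneg) (auto simp: mem_Times_iff)
  then show "(\<lambda>n. case u n of (\<sigma>, x) \<Rightarrow> run (min (clock \<sigma>) (hit x)) x)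
      \<longlonglongrightarrow> (case p of (\<sigma>, x) \<Rightarrow> run (min (clock \<sigma>) (hit x)) x)"
    by (simp add: case_prod_unfold)
qed

lemma run_at_level:
  assumes "x \<in> Z" "V x = c" "0 \<le> e"
  shows "run (min e (hit x)) x = x"
proof (cases "x = E")
  case True
  then show ?thesis using assms(3) hit_nonneg[OF assms(1)] by simp
next
  case False
  then show ?thesis using assms hit_at_level[of x] by (simp add: min_def)
qed

text \<open>Pasting lemma: the parts \<open>V x \<le> c\<close> and \<open>V x \<ge> c\<close> are
  relatively closed and overlap only at level \<open>c\<close>.\<close>

lemma continuous_on_deform:
  "continuous_on ({0..1} \<times> sublevel (basin S A) V b) (\<lambda>(\<sigma>, x). deform \<sigma> x)"
proof -
  let ?I = "{0..1::real}"
  let ?X = "?I \<times> sublevel (basin S A) V b"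
  let ?L = "?I \<times> sublevel (basin S A) V c"
  have X: "?X = ?L \<union> ?I \<times> Z"
    using c_le_b by (auto simp: sublevel_def Z_def)
  have V: "continuous_on ?X (\<lambda>p. V (snd p))"
    by (rule continuous_on_compose2[OF V_continuous continuous_on_snd[OF continuous_on_id]])
      (auto simp: sublevel_def)
  have "?L = ?X \<inter> (\<lambda>p. V (snd p)) -` {..c}" "?I \<times> Z = ?X \<inter> (\<lambda>p. V (snd p)) -` {c..}"
    using c_le_b by (auto simp: sublevel_def Z_def)
  then have closed: "closedin (top_of_set ?X) ?L" "closedin (top_of_set ?X) (?I \<times> Z)"
    using V by (metis continuous_closedin_preimage closed_atMost closed_atLeast)+
  have "continuous_on (?L \<union> ?I \<times> Z)
      (\<lambda>p. if V (snd p) \<le> c then snd p else (\<lambda>(\<sigma>, x). run (min (clock \<sigma>) (hit x)) x) p)"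
  proof (rule continuous_on_cases_local)
    show "continuous_on (?I \<times> Z) (\<lambda>(\<sigma>, x). run (min (clock \<sigma>) (hit x)) x)"
      by (rule continuous_on_run_Z)
    show "snd p = (case p of (\<sigma>, x) \<Rightarrow> run (min (clock \<sigma>) (hit x)) x)"
      if p: "p \<in> ?L \<and> \<not> V (snd p) \<le> c \<or> p \<in> ?I \<times> Z \<and> V (snd p) \<le> c" for p
    proof -
      from p have "snd p \<in> Z" "V (snd p) = c" "0 \<le> fst p"
        by (auto simp: sublevel_def Z_def)
      then show ?thesis
        by (simp add: case_prod_unfold run_at_level clock_nonneg)
    qed
  qed (use closed X in \<open>auto intro: continuous_intros\<close>)
  then show ?thesis
    unfolding X deform_def case_prod_unfold .
qed

text \<open>At \<sigma> = 1 the clock is infinite, so the cap \<open>hit x\<close> is attained and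
  the point has come down to height at most \<open>c\<close>.\<close>

lemma sublevel_strong_deformation_retract:
  "strong_deformation_retract (sublevel (basin S A) V c) (sublevel (basin S A) V b)"
  unfolding strong_deformation_retract_def
proof (intro conjI exI[of _ deform] ballI)
  let ?L = "sublevel (basin S A) V"
  show "?L c \<subseteq> ?L b"
    using c_le_b by (auto simp: sublevel_def)
  show "continuous_on ({0..1} \<times> ?L b) (\<lambda>(\<sigma>, x). deform \<sigma> x)"
    by (rule continuous_on_deform)
  show "deform \<sigma> x = x" if "x \<in> ?L c" for \<sigma> x
    using that by (simp add: deform_def sublevel_def)
  have Z: "x \<in> Z" if "x \<in> ?L b" "\<not> V x \<le> c" for x
    using that by (simp add: sublevel_def Z_def)
  show "deform \<sigma> x \<in> ?L b" if "\<sigma> \<in> {0..1}" "x \<in> ?L b" for \<sigma> x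
  proof (cases "V x \<le> c")
    case False
    then have "V (run (min (clock \<sigma>) (hit x)) x) \<le> V x" "run (min (clock \<sigma>) (hit x)) x \<in> basin S A"
      using Z that by (auto intro!: V_run_le run_in_basin simp: hit_nonneg clock_nonneg)
    with False that(2) show ?thesis
      by (simp add: deform_def sublevel_def)
  qed (use that in \<open>simp add: deform_def\<close>)
  show "deform 0 x = x" if "x \<in> ?L b" for x
    using Z that by (simp add: deform_def hit_nonneg min_absorb1)
  show "deform 1 x \<in> ?L c" if "x \<in> ?L b" for x
    using Z that by (auto simp: deform_def sublevel_def V_run_hit run_in_basin hit_nonneg)
qed

end

theorem theorem5p3:
  fixes S :: "real \<Rightarrow> 'a::complete_space \<Rightarrow> 'a"
    and \<A> \<Omega> :: "'a set"
    and l k\<^sub>0 :: nat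
    and M :: "nat \<Rightarrow> 'a set"
    and V :: "'a \<Rightarrow> real"
    and E :: 'a
    and b c :: real
  assumes "semiflow S"
    and "asymptotically_compact S"
    and "attractor S \<A>"
    and "\<Omega> = basin S \<A>"
    and "morse_decomposition S \<A> l M"
    and "strict_morse_lyapunov S \<Omega> l M V"
    and "1 \<le> k\<^sub>0" and "k\<^sub>0 \<le> l"
    and "M k\<^sub>0 = {E}"
    and "equilibrium S E"
    and "c = V E"
    and "c < b"
    and "critical_values l M V \<inter> {c<..b} = {}"
  shows "strong_deformation_retract (sublevel \<Omega> V c) (sublevel \<Omega> V b)"
proof -
  obtain A where A: "\<And>k. k \<in> {0..l} \<Longrightarrow> attractor_in S \<A> (A k)"
    and M: "\<And>k. k \<in> {1..l} \<Longrightarrow> M k = A k \<inter> dual_repeller S \<A> (A (k - 1))"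
    using assms(5) unfolding morse_decomposition_def by blast
  have k: "k\<^sub>0 \<in> {1..l}"
    using assms(7,8) by simp
  \<comment> \<open>Morse sets lie in the attractor; this also makes \<A> nonempty.\<close>
  have "E \<in> A k\<^sub>0"
    using M[OF k] assms(9) by blast
  moreover have "A k\<^sub>0 \<subseteq> \<A>"
    using A[of k\<^sub>0] k by (simp add: attractor_in_def)
  ultimately have E: "E \<in> \<A>" by blast
  have strict: "V x < V y" if "i \<in> {1..l}" "j \<in> {1..l}" "i < j" "x \<in> M i" "y \<in> M j" for i j x y
    using assms(6) that unfolding strict_morse_lyapunov_def by blast
  have EM: "E \<in> M k\<^sub>0"
    using assms(9) by simp
  interpret descending_semiflow S \<A> V E b c
  proof
    show "continuous_on (basin S \<A>) V"
      using assms(4,6) by (simp add: strict_morse_lyapunov_def morse_lyapunov_def)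
    fix x assume x: "x \<in> basin S \<A>" "c \<le> V x" "V x \<le> b" "x \<noteq> E"
    \<comment> \<open>A Morse point in the strip has height \<open>c\<close>, as there are no
      critical values in \<open>{c<..b}\<close>. Strictness of \<open>V\<close> then forces
      \<open>j = k\<^sub>0\<close>, so the point would be \<open>E\<close>.\<close>
    have "x \<notin> M j" if j: "j \<in> {1..l}" for j
    proof
      assume xj: "x \<in> M j"
      then have "V x \<in> critical_values l M V"
        using j unfolding critical_values_def by blast
      with assms(13) x have "V x = V E"
        using assms(11) by (cases "V x = c") auto
      moreover have "V x < V E" if "j < k\<^sub>0"
        using strict[OF j k that xj EM] .
      moreover have "V E < V x" if "k\<^sub>0 < j"
        using strict[OF k j that EM xj] .
      ultimately have "j = k\<^sub>0"
        by (metis less_irrefl linorder_neqE_nat)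
      then show False
        using xj assms(9) x(4) by simp
    qed
    then show "monotone_on {0..} (<) (>) (\<lambda>t. V (S t x))"
      using assms(4,6) x(1) by (auto simp: strict_morse_lyapunov_def morse_lyapunov_def)
  qed (use assms E in auto)
  show ?thesis
    unfolding assms(4) by (rule sublevel_strong_deformation_retract)
qed

end
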